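(* Let $f$, $x_k$, $\Delta_k$, $Y_k$, $\widehat A_k$, $b_k$, $\widehat c_k^\pi$, $\widehat W_k$ be as in the context, and suppose: (i) $f$ is continuously differentiable on a neighborhood containing all trust regions $B(x_k,\Delta_k)$ visited by the algorithm, its gradient is Lipschitz with constant $L_g>0$, i.e. $\|\nabla f(x)-\nabla f(z)\|_2\le L_g\|x-z\|_2$, and $f$ is bounded below by some $f_{\inf}\in\mathbb{R}$; (ii) $w_{\min}I\preceq\widehat W_k\preceq w_{\max}I$ for all $k$, where $0<w_{\min}\le w_{\max}<\infty$; (iii) $\lambda_{\min}\big(\widehat A_k\widehat W_k^{-1}\widehat A_k^\top\big)\ge\mu_M$ for all $k$, where $\mu_M>0$; (iv) $\|\widehat c_k^\pi-\widehat c_k^\ell\|_{\widehat W_k}\le\bar\kappa_\pi\Delta_k^2$ for all $k$, for some constant $\bar\kappa_\pi\ge0$, where $\widehat c_k^\ell=[f(x_k);\Delta_k\nabla f(x_k);0]\in\mathbb{R}^q$. Let $\widehat c_k$ be the hard-MAP solution on $Y_k$ and $m_k$ the corresponding quadratic model with Hessian $H_k$. Define $$\kappa_e:=\frac{\bar\kappa_\pi}{\sqrt{w_{\min}}}+\frac{c_{\mathrm{trim}}^2\,B_\phi^{\mathrm{geo}}\,L_g\,(m+1)}{2\,w_{\min}\,\mu_M}.$$ Then $m_k$ is fully linear on $B(x_k,\Delta_k)$ with constants $$\kappa_f:=\frac{L_g}{2}+B_\phi\,\kappa_e,\qquad \kappa_g:=L_g+(1+\sqrt2)\,\kappa_e,$$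 i.e. for all $\|s\|_2\le\Delta_k$, $$|f(x_k+s)-m_k(s)|\le\kappa_f\Delta_k^2,\qquad \|\nabla f(x_k+s)-\nabla m_k(s)\|_2\le\kappa_g\Delta_k,$$ and the model Hessian is uniformly bounded: $\|H_k\|_2\le H_{\max}:=\sqrt2\,\kappa_e$ for all $k$.
   Context: The setting is a derivative-free trust-region algorithm minimizing $f:\mathbb{R}^n\to\mathbb{R}$, with iterations $k=0,1,2,\dots$. $B(x,r)=\{z\in\mathbb{R}^n:\|z-x\|_2\le r\}$; $\|v\|_W:=\sqrt{v^\top Wv}$; $q=(n+1)(n+2)/2$, $q_H=n(n+1)/2$. For symmetric $H\in\mathbb{R}^{n\times n}$, $\mathrm{vech}(H)\in\mathbb{R}^{q_H}$ stacks the diagonal entries and then the strictly upper-triangular entries; $\mathrm{qvec}(u)=(\tfrac12u_1^2,\dots,\tfrac12u_n^2,u_1u_2,\dots,u_{n-1}u_n)^\top$ in the same order, so $\mathrm{qvec}(u)^\top\mathrm{vech}(H)=\frac12u^\top Hu$. Let $\widehat\phi(u)=[1;u;\mathrm{qvec}(u)]\in\mathbb{R}^q$. For each $k$: $x_k\in\mathbb{R}^n$ is the center, $\Delta_k\in(0,\Delta_{\max}]$ the trust-region radius (the trust region is $B(x_k,\Delta_k)$), $c_{\mathrm{trim}}\ge1$ a fixed constant, and $Y_k=\{y_k^{(0)}=x_k,y_k^{(1)},\dots,y_k^{(m)}\}\subset B(x_k,c_{\mathrm{trim}}\Delta_k)$ the interpolation set after geometry management. $\widehat A_k\in\mathbb{R}^{(m+1)\times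 q}$ has rows $\widehat\phi((y_k^{(i)}-x_k)/\Delta_k)^\top$ and $b_k=(f(y_k^{(i)}))_{i=0}^m$. Given a prior mean $\widehat c_k^\pi\in\mathbb{R}^q$ and a symmetric positive definite $\widehat W_k\in\mathbb{R}^{q\times q}$, the hard-MAP solution is $$\widehat c_k=\arg\min_{\widehat c\in\mathbb{R}^q}\tfrac12\|\widehat c-\widehat c_k^\pi\|_{\widehat W_k}^2\ \text{ s.t. }\ \widehat A_k\widehat c=b_k,$$ equivalently, with $\widehat M_k=\widehat A_k\widehat W_k^{-1}\widehat A_k^\top$ invertible, $\widehat c_k=\widehat c_k^\pi+\widehat W_k^{-1}\widehat A_k^\top\widehat M_k^{-1}(b_k-\widehat A_k\widehat c_k^\pi)$. Writing $\widehat c_k=[\widehat c_k^{(0)};\widehat c_k^{(g)};\widehat c_k^{(H)}]\in\mathbb{R}\times\mathbb{R}^n\times\mathbb{R}^{q_H}$, the model is $m_k(s)=\widehat c_k^{(0)}+g_k^\top s+\frac12s^\top H_ks$ with $g_k=\Delta_k^{-1}\widehat c_k^{(g)}$, $\mathrm{vech}(H_k)=\Delta_k^{-2}\widehat c_k^{(H)}$. Constants: $B_\phi:=\sup_{\|u\|_2\le1}\|\widehat\phi(u)\|_2$ and $B_\phi^{\mathrm{geo}}:=\sup_{\|u\|_2\le c_{\mathrm{trim}}}\|\widehat\phi(u)\|_2$.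
   Formalization: The neighborhood in (i) is also required to contain the segments from x_k to each interpolation point y_k^(i); without this the claim fails when c_trim > 1, since f(y_k^(i)) is then unconstrained. This is automatic if c_trim = 1. *)

theory Defs
  imports "HOL-Analysis.Analysis"
begin

text \<open>
  The coordinates of \<open>vech\<close> and \<open>qvec\<close> are labelled by the positions
  \<open>(i, j)\<close> with \<open>i \<le> j\<close> of the upper triangle rather than by
  \<open>1, \<dots>, n(n+1)/2\<close>: \<open>(i, i)\<close> labels a diagonal entry and
  \<open>(i, j)\<close> with \<open>i < j\<close> a strictly upper-triangular one.  Cartesian vectors in
  HOL are not ordered, so the stacking order only matters in that \<open>vech\<close> and
  \<open>qvec\<close> must use the same one.
\<close>

typedef (overloaded) 'n upper = "{(i :: 'n :: linorder, j). i \<le> j}"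
  by auto

instance upper :: ("{finite, linorder}") finite
proof
  have "inj (Rep_upper :: 'a upper \<Rightarrow> _)"
    by (simp add: inj_def Rep_upper_inject)
  then show "finite (UNIV :: 'a upper set)"
    by (rule finite_imageD[rotated]) (rule finite)
qed

definition row_ix :: "'n::linorder upper \<Rightarrow> 'n" where
  "row_ix p = fst (Rep_upper p)"

definition col_ix :: "'n::linorder upper \<Rightarrow> 'n" where
  "col_ix p = snd (Rep_upper p)"

text \<open>Index type of \<open>[c0; cg; cH]\<close>, of cardinality \<open>q = (n+1)(n+2)/2\<close>.\<close>

type_synonym 'n quad_ix = "unit + ('n + 'n upper)"

definition blocks :: "real \<Rightarrow> real^'n::{finite,linorder} \<Rightarrow> real^('n::{finite,linorder} upper) \<Rightarrow> real^('n::{finite,linorder} quad_ix)" where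
  "blocks c0 cg cH =
     (\<chi> a. case a of Inl _ \<Rightarrow> c0 | Inr (Inl i) \<Rightarrow> cg $ i | Inr (Inr p) \<Rightarrow> cH $ p)"

definition const_part :: "real^('n::{finite,linorder} quad_ix) \<Rightarrow> real" where
  "const_part c = c $ Inl ()"

definition lin_part :: "real^('n::{finite,linorder} quad_ix) \<Rightarrow> real^'n::{finite,linorder}" where
  "lin_part c = (\<chi> i. c $ Inr (Inl i))"

definition quad_part :: "real^('n::{finite,linorder} quad_ix) \<Rightarrow> real^('n::{finite,linorder} upper)" where
  "quad_part c = (\<chi> p. c $ Inr (Inr p))"

definition vech :: "real^'n::{finite,linorder}^'n::{finite,linorder} \<Rightarrow> real^('n::{finite,linorder} upper)" where
  "vech H = (\<chi> p. H $ row_ix p $ col_ix p)"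

definition qvec :: "real^'n::{finite,linorder} \<Rightarrow> real^('n::{finite,linorder} upper)" where
  "qvec u = (\<chi> p. if row_ix p = col_ix p then 1/2 * (u $ row_ix p)\<^sup>2
                  else u $ row_ix p * u $ col_ix p)"

definition phihat :: "real^'n::{finite,linorder} \<Rightarrow> real^('n::{finite,linorder} quad_ix)" where
  "phihat u = blocks 1 u (qvec u)"

definition wnorm :: "real^'q^'q \<Rightarrow> real^'q \<Rightarrow> real" where
  "wnorm W v = sqrt (v \<bullet> (W *v v))"

definition sym_pos_def :: "real^'q^'q \<Rightarrow> bool" where
  "sym_pos_def W \<longleftrightarrow> transpose W = W \<and> (\<forall>v. v \<noteq> 0 \<longrightarrow> 0 < v \<bullet> (W *v v))"

definition loewner_le :: "real^'q^'q \<Rightarrow> real^'q^'q \<Rightarrow> bool" (infix "\<preceq>\<^sub>L" 50) where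
  "A \<preceq>\<^sub>L B \<longleftrightarrow> (\<forall>v. 0 \<le> v \<bullet> ((B - A) *v v))"

definition eigenvalues :: "real^'q^'q \<Rightarrow> real set" where
  "eigenvalues A = {l. \<exists>v. v \<noteq> 0 \<and> A *v v = l *\<^sub>R v}"

text \<open>Only meaningful for symmetric matrices, whose (real) spectrum is finite and nonempty.\<close>

definition lambda_min :: "real^'q^'q \<Rightarrow> real" where
  "lambda_min A = Min (eigenvalues A)"

definition spectral_norm :: "real^'n^'m \<Rightarrow> real" where
  "spectral_norm A = onorm ((*v) A)"

definition gradient :: "('a::real_inner \<Rightarrow> real) \<Rightarrow> 'a \<Rightarrow> 'a" where
  "gradient f x = (THE D. GDERIV f x :> D)"

text \<open>Interpolation points are indexed by a finite type \<open>'p\<close> with \<open>m + 1\<close> elements.\<close>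

definition design_matrix ::
    "real^'n::{finite,linorder} \<Rightarrow> real \<Rightarrow> ('p \<Rightarrow> real^'n::{finite,linorder}) \<Rightarrow> real^('n::{finite,linorder} quad_ix)^'p" where
  "design_matrix x \<Delta> y = (\<chi> i. phihat ((y i - x) /\<^sub>R \<Delta>))"

definition hard_MAP :: "real^'q^'p \<Rightarrow> real^'p \<Rightarrow> real^'q^'q \<Rightarrow> real^'q \<Rightarrow> real^'q" where
  "hard_MAP A b W c\<pi> = (ARG_MIN (\<lambda>c. 1/2 * (wnorm W (c - c\<pi>))\<^sup>2) c. A *v c = b)"

definition fully_linear ::
    "('a::real_inner \<Rightarrow> real) \<Rightarrow> ('a \<Rightarrow> real) \<Rightarrow> 'a \<Rightarrow> real \<Rightarrow> real \<Rightarrow> real \<Rightarrow> bool" where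
  "fully_linear f mdl x \<Delta> \<kappa>f \<kappa>g \<longleftrightarrow>
     (\<forall>s. norm s \<le> \<Delta> \<longrightarrow>
        \<bar>f (x + s) - mdl s\<bar> \<le> \<kappa>f * \<Delta>\<^sup>2 \<and>
        norm (gradient f (x + s) - gradient mdl s) \<le> \<kappa>g * \<Delta>)"

lemma row_le_col: "row_ix p \<le> col_ix p"
  using Rep_upper[of p] by (auto simp: row_ix_def col_ix_def)

lemma sum_upper:
  fixes g :: "'n::{finite,linorder} \<Rightarrow> 'n \<Rightarrow> 'b::comm_monoid_add"
  shows "(\<Sum>p\<in>UNIV. g (row_ix p) (col_ix p)) = (\<Sum>(i, j) | i \<le> j. g i j)"
proof -
  have b: "bij_betw Rep_upper (UNIV :: 'n upper set) {(i, j). i \<le> j}"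
    by (metis bij_betw_def Rep_upper_inject inj_onI type_definition.Rep_range[OF type_definition_upper])
  show ?thesis
    using sum.reindex_bij_betw[OF b, of "\<lambda>(i, j). g i j"]
    by (simp add: row_ix_def col_ix_def case_prod_beta)
qed

lemma sum_square_split:
  fixes g :: "'n::{finite,linorder} \<Rightarrow> 'n \<Rightarrow> 'b::comm_monoid_add"
  shows "(\<Sum>i\<in>UNIV. \<Sum>j\<in>UNIV. g i j)
       = (\<Sum>i\<in>UNIV. g i i) + (\<Sum>(i, j) | i < j. g i j + g j i)"
proof -
  have U: "(UNIV :: ('n \<times> 'n) set) = {(i, j). i = j} \<union> ({(i, j). i < j} \<union> {(i, j). j < i})"
    by auto
  have "(\<Sum>i\<in>UNIV. \<Sum>j\<in>UNIV. g i j) = (\<Sum>(i, j)\<in>UNIV. g i j)"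
    by (simp add: sum.cartesian_product)
  also have "\<dots> = (\<Sum>(i, j) | i = j. g i j)
      + ((\<Sum>(i, j) | i < j. g i j) + (\<Sum>(i, j) | j < i. g i j))"
    by (subst U, subst sum.union_disjoint, (auto)[3], subst sum.union_disjoint) auto
  also have "(\<Sum>(i, j) | i = j. g i j) = (\<Sum>i\<in>UNIV. g i i)"
    by (rule sum.reindex_bij_witness[of _ "\<lambda>i. (i, i)" fst]) auto
  also have "(\<Sum>(i, j) | j < i. g i j) = (\<Sum>(i, j) | i < j. g j i)"
    by (rule sum.reindex_bij_witness[of _ "\<lambda>(i, j). (j, i)" "\<lambda>(i, j). (j, i)"]) auto
  also have "(\<Sum>(i, j) | i < j. g i j) + (\<Sum>(i, j) | i < j. g j i)
      = (\<Sum>(i, j) | i < j. g i j + g j i)"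
    by (subst sum.distrib[symmetric], rule sum.cong) auto
  finally show ?thesis .
qed

lemma sum_upper_split:
  fixes g :: "'n::{finite,linorder} \<Rightarrow> 'n \<Rightarrow> 'b::comm_monoid_add"
  shows "(\<Sum>(i, j) | i \<le> j. g i j) = (\<Sum>i\<in>UNIV. g i i) + (\<Sum>(i, j) | i < j. g i j)"
proof -
  have U: "{(i :: 'n, j). i \<le> j} = {(i, j). i = j} \<union> {(i, j). i < j}"
    by auto
  have "(\<Sum>(i, j) | i = j. g i j) = (\<Sum>i\<in>UNIV. g i i)"
    by (rule sum.reindex_bij_witness[of _ "\<lambda>i. (i, i)" fst]) auto
  then show ?thesis
    by (subst U, subst sum.union_disjoint) auto
qed

lemma card_quad_ix:
  "CARD('n::{finite,linorder} quad_ix) = (CARD('n) + 1) * (CARD('n) + 2) div 2"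
proof -
  let ?T = "card {(i :: 'n, j). i < j}"
  have "CARD('n) * CARD('n) = CARD('n) + 2 * ?T"
    using sum_square_split[of "\<lambda>(i::'n) (j::'n). 1 :: nat"]
    by (simp add: case_prod_beta)
  moreover have "CARD('n upper) = CARD('n) + ?T"
    using sum_upper[of "\<lambda>(i::'n) (j::'n). 1 :: nat"] sum_upper_split[of "\<lambda>(i::'n) (j::'n). 1 :: nat"]
    by (simp add: case_prod_beta)
  ultimately show ?thesis
    by (simp add: algebra_simps)
qed

lemma qvec_vech:
  fixes H :: "real^'n::{finite,linorder}^'n::{finite,linorder}"
  assumes "transpose H = H"
  shows "qvec u \<bullet> vech H = 1/2 * (u \<bullet> (H *v u))"
proof -
  have sym: "H $ j $ i = H $ i $ j" for i j
    using assms by (metis transpose_def vec_lambda_beta)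
  let ?g = "\<lambda>i j. (if i = j then 1/2 * (u $ i)\<^sup>2 else u $ i * u $ j) * H $ i $ j"
  let ?h = "\<lambda>i j. u $ i * (H $ i $ j * u $ j)"
  have "qvec u \<bullet> vech H = (\<Sum>p\<in>UNIV. ?g (row_ix p) (col_ix p))"
    by (simp add: inner_vec_def qvec_def vech_def)
  also have "\<dots> = (\<Sum>i\<in>UNIV. ?g i i) + (\<Sum>(i, j) | i < j. ?g i j)"
    using sum_upper[of ?g] sum_upper_split[of ?g] by (rule trans)
  also have "(\<Sum>i\<in>UNIV. ?g i i) = 1/2 * (\<Sum>i\<in>UNIV. ?h i i)"
    by (simp add: sum_distrib_left power2_eq_square mult_ac)
  also have "(\<Sum>(i, j) | i < j. ?g i j) = 1/2 * (\<Sum>(i, j) | i < j. ?h i j + ?h j i)"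
    unfolding sum_distrib_left
    by (rule sum.cong) (auto simp: sym algebra_simps)
  finally have "qvec u \<bullet> vech H = 1/2 * (\<Sum>i\<in>UNIV. \<Sum>j\<in>UNIV. ?h i j)"
    by (simp only: sum_square_split distrib_left)
  then show ?thesis
    by (simp add: inner_vec_def matrix_vector_mult_def sum_distrib_left)
qed

end

theory Submission
  imports Defs
begin

text \<open>
  In the scaled variable \<open>u = s / \<Delta>\<close> the model and the first-order Taylor polynomial of \<open>f\<close> are
  \<open>phihat u \<bullet> c\<close> and \<open>phihat u \<bullet> cl\<close>, so everything reduces to \<open>norm (c - cl) \<le> \<kappa>e * \<Delta>\<^sup>2\<close>.
  This error splits into a \<open>W\<close>-orthogonal projection of the prior error and the minimum-norm
  correction of the residual \<open>b - A cl\<close>, whose entries are Taylor remainders of order \<open>\<Delta>\<^sup>2\<close>.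
  The Hessian is controlled by its Frobenius norm, at most \<open>sqrt 2\<close> times that of \<open>vech\<close>.
\<close>

section \<open>Symmetric and positive definite matrices\<close>

lemma inner_symmetric_matrix:
  fixes S :: "real^'a::finite^'a"
  assumes "transpose S = S"
  shows "u \<bullet> (S *v v) = v \<bullet> (S *v u)"
  by (metis assms dot_lmul_matrix inner_commute transpose_matrix_vector)

lemma eigenvectors_orthogonal:
  fixes S :: "real^'a::finite^'a"
  assumes "transpose S = S" "S *v u = k *\<^sub>R u" "S *v v = l *\<^sub>R v" "k \<noteq> l"
  shows "u \<bullet> v = 0"
proof -
  have "k * (u \<bullet> v) = l * (u \<bullet> v)"
    using inner_symmetric_matrix[OF assms(1), of u v] assms(2,3)
    by (auto simp: inner_commute[of v u])
  then show ?thesis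
    using \<open>k \<noteq> l\<close> by (metis mult_cancel_right)
qed

text \<open>One eigenvector chosen per eigenvalue gives a family of nonzero, pairwise orthogonal,
  hence independent vectors, so the family is finite. The choice is injective because a nonzero
  vector is not orthogonal to itself. Finiteness gives \<open>Min\<close> in
  \<open>lambda_min\<close> its meaning.\<close>

lemma finite_eigenvalues:
  fixes S :: "real^'a::finite^'a"
  assumes "transpose S = S"
  shows "finite (eigenvalues S)"
proof -
  define e where "e l = (SOME v. v \<noteq> 0 \<and> S *v v = l *\<^sub>R v)" for l
  have e: "e l \<noteq> 0" "S *v e l = l *\<^sub>R e l" if "l \<in> eigenvalues S" for l
  proof -
    have "\<exists>v. v \<noteq> 0 \<and> S *v v = l *\<^sub>R v"
      using that by (simp add: eigenvalues_def)
    from someI_ex[OF this] show "e l \<noteq> 0" "S *v e l = l *\<^sub>R e l"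
      by (simp_all add: e_def)
  qed
  have ortho: "e k \<bullet> e l = 0" if "k \<in> eigenvalues S" "l \<in> eigenvalues S" "k \<noteq> l" for k l
    using eigenvectors_orthogonal[OF assms] e that by blast
  have "pairwise orthogonal (e ` eigenvalues S)"
    by (auto simp: pairwise_def orthogonal_def intro: ortho)
  moreover have "0 \<notin> e ` eigenvalues S"
    using e(1) by force
  ultimately have "finite (e ` eigenvalues S)"
    by (intro finiteI_independent pairwise_orthogonal_independent)
  moreover have "inj_on e (eigenvalues S)"
    by (rule inj_onI) (metis e(1) inner_eq_zero_iff ortho)
  ultimately show ?thesis
    by (rule finite_imageD)
qed

lemma mat_mult_vector: "mat a *v v = a *\<^sub>R v" for v :: "real^'a::finite"
  by (simp add: vec_eq_iff matrix_vector_mult_def mat_def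
      if_distrib[where f = "\<lambda>x. x * _"] cong: if_cong)

text \<open>Moving from \<open>v\<close> along \<open>- (S *v v)\<close> changes the form, which is
  zero at \<open>v\<close>, by a first-order term \<open>- 2 * t * ?a\<close>. For some t > 0 this
  would make it negative unless \<open>?a = 0\<close>.\<close>

lemma positive_semidefinite_kernel:
  fixes S :: "real^'a::finite^'a"
  assumes sym: "transpose S = S" and psd: "\<And>v. 0 \<le> v \<bullet> (S *v v)" and zero: "v \<bullet> (S *v v) = 0"
  shows "S *v v = 0"
proof -
  let ?w = "S *v v"
  let ?a = "?w \<bullet> ?w" and ?b = "?w \<bullet> (S *v ?w)"
  have exp: "0 \<le> t\<^sup>2 * ?b - 2 * t * ?a" for t :: real
  proof -
    have "(v - t *\<^sub>R ?w) \<bullet> (S *v (v - t *\<^sub>R ?w)) = t\<^sup>2 * ?b - 2 * t * ?a"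
      using zero inner_symmetric_matrix[OF sym, of v ?w]
      by (simp add: matrix_vector_mult_diff_distrib matrix_vector_mult_scaleR
          inner_diff_left inner_diff_right power2_eq_square right_diff_distrib)
    then show ?thesis
      using psd[of "v - t *\<^sub>R ?w"] by simp
  qed
  have "?a \<le> 0"
  proof (cases "?b = 0")
    case True
    then show ?thesis using exp[of 1] by simp
  next
    case False
    then have "0 < ?b" using psd[of ?w] by simp
    \<comment> \<open>The value \<open>?a / ?b\<close> of t minimizes the quadratic in
      \<open>exp\<close>.\<close>
    then have "(?a / ?b)\<^sup>2 * ?b - 2 * (?a / ?b) * ?a = - (?a\<^sup>2 / ?b)"
      by (simp add: field_simps power2_eq_square)
    then have "?a\<^sup>2 / ?b \<le> 0"
      using exp[of "?a / ?b"] by simp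
    then show ?thesis
      using \<open>0 < ?b\<close> by (simp add: divide_le_0_iff)
  qed
  then show ?thesis
    by (metis inner_eq_zero_iff inner_ge_zero order_antisym)
qed

text \<open>By compactness the form attains its minimum \<open>l\<close> on the unit sphere. Then
  \<open>S - mat l\<close> is positive semidefinite and its form vanishes at the minimizer, which is
  therefore an eigenvector for \<open>l\<close>, so \<open>lambda_min S\<close> is at most
  \<open>l\<close>.\<close>

lemma lambda_min_le_rayleigh:
  fixes S :: "real^'a::finite^'a"
  assumes sym: "transpose S = S"
  shows "lambda_min S * (norm v)\<^sup>2 \<le> v \<bullet> (S *v v)"
proof -
  have "continuous_on (sphere 0 1) (\<lambda>v. v \<bullet> (S *v v))"
    by (intro continuous_intros linear_continuous_on matrix_vector_mul_bounded_linear)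
  moreover have "sphere (0 :: real^'a) 1 \<noteq> {}"
    by simp
  ultimately obtain v0 where v0: "norm v0 = 1"
    and min: "\<And>v. norm v = 1 \<Longrightarrow> v0 \<bullet> (S *v v0) \<le> v \<bullet> (S *v v)"
    using continuous_attains_inf[of "sphere (0 :: real^'a) 1" "\<lambda>v. v \<bullet> (S *v v)"]
    by (auto simp: dist_norm)
  define l where "l = v0 \<bullet> (S *v v0)"
  have rayleigh: "l * (norm v)\<^sup>2 \<le> v \<bullet> (S *v v)" for v
  proof (cases "v = 0")
    case False
    have "l \<le> (v /\<^sub>R norm v) \<bullet> (S *v (v /\<^sub>R norm v))"
      unfolding l_def using False by (intro min) simp
    then show ?thesis
      using False by (simp add: matrix_vector_mult_scaleR field_simps power2_eq_square)
  qed simp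
  define T where "T = S - mat l"
  have T: "T *v v = S *v v - l *\<^sub>R v" for v
    by (simp add: T_def matrix_vector_mult_diff_rdistrib mat_mult_vector)
  have "transpose T = T"
    using sym by (auto simp: T_def transpose_def vec_eq_iff mat_def)
  moreover have "0 \<le> v \<bullet> (T *v v)" for v
    using rayleigh[of v] by (simp add: T inner_diff_right power2_norm_eq_inner)
  moreover have "v0 \<bullet> (T *v v0) = 0"
    using v0 by (simp add: T inner_diff_right l_def flip: power2_norm_eq_inner)
  ultimately have "T *v v0 = 0"
    by (rule positive_semidefinite_kernel)
  then have "l \<in> eigenvalues S"
    using v0 T[of v0] by (auto simp: eigenvalues_def intro!: exI[of _ v0])
  then have "lambda_min S \<le> l"
    unfolding lambda_min_def by (intro Min_le finite_eigenvalues sym)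
  then have "lambda_min S * (norm v)\<^sup>2 \<le> l * (norm v)\<^sup>2"
    by (intro mult_right_mono) simp_all
  then show ?thesis
    using rayleigh[of v] by linarith
qed

text \<open>Cauchy-Schwarz, with one factor \<open>norm u\<close> cancelled. Applied with
  \<open>v\<close> the image of \<open>u\<close> under a coercive matrix, it bounds the action of
  the inverse, both for \<open>W\<close> and for \<open>M\<close>.\<close>

lemma coercive_imp_norm_le:
  fixes u v :: "'a::real_inner"
  assumes "0 < a" "a * (norm u)\<^sup>2 \<le> u \<bullet> v"
  shows "norm u \<le> norm v / a"
proof (cases "u = 0")
  case False
  have "a * (norm u)\<^sup>2 \<le> norm u * norm v"
    using assms(2) norm_cauchy_schwarz[of u v] by linarith
  then have "a * norm u \<le> norm v"
    using False by (simp add: power2_eq_square mult.left_commute)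
  then show ?thesis
    using assms(1) by (simp add: field_simps)
qed (use assms(1) in simp)

lemma invertible_if_kernel_trivial:
  fixes S :: "real^'a::finite^'a"
  assumes "\<And>v. S *v v = 0 \<Longrightarrow> v = 0"
  shows "invertible S"
  using assms by (metis invertible_left_inverse matrix_left_invertible_ker)

lemma matrix_inv_mult_vector:
  fixes S :: "real^'a::finite^'a"
  assumes "invertible S"
  shows "S *v (matrix_inv S *v v) = v"
proof -
  have "S ** matrix_inv S = mat 1 \<and> matrix_inv S ** S = mat 1"
    unfolding matrix_inv_def using assms[unfolded invertible_def] by (rule someI_ex)
  then show ?thesis
    by (simp add: matrix_vector_mul_assoc)
qed

lemma invertible_sym_pos_def:
  assumes "sym_pos_def W"
  shows "invertible W"
  using assms by (intro invertible_if_kernel_trivial) (force simp: sym_pos_def_def)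

lemma sym_pos_def_nonneg: "0 \<le> v \<bullet> (W *v v)" if "sym_pos_def W"
  using that by (cases "v = 0") (auto simp: sym_pos_def_def less_imp_le)

lemma wnorm_power2: "(wnorm W v)\<^sup>2 = v \<bullet> (W *v v)" if "sym_pos_def W"
  using sym_pos_def_nonneg[OF that] by (simp add: wnorm_def)

lemma wnorm_nonneg: "0 \<le> wnorm W v" if "sym_pos_def W"
  using sym_pos_def_nonneg[OF that] by (simp add: wnorm_def)

lemma wnorm_add_orthogonal:
  assumes W: "sym_pos_def W" and "u \<bullet> (W *v v) = 0"
  shows "(wnorm W (u + v))\<^sup>2 = (wnorm W u)\<^sup>2 + (wnorm W v)\<^sup>2"
  using assms inner_symmetric_matrix[of W u v]
  by (simp add: wnorm_power2 sym_pos_def_def matrix_vector_right_distrib inner_add_left inner_add_right)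

lemma loewner_mat_le:
  assumes "mat a \<preceq>\<^sub>L W"
  shows "a * (norm v)\<^sup>2 \<le> v \<bullet> (W *v v)"
  using assms
  by (simp add: loewner_le_def matrix_vector_mult_diff_rdistrib mat_mult_vector
      inner_diff_right power2_norm_eq_inner)

lemma norm_le_wnorm:
  assumes "sym_pos_def W" "0 < a" "mat a \<preceq>\<^sub>L W"
  shows "norm v \<le> wnorm W v / sqrt a"
proof -
  have "sqrt (a * (norm v)\<^sup>2) \<le> wnorm W v"
    unfolding wnorm_def by (intro real_sqrt_le_mono loewner_mat_le assms)
  then show ?thesis
    using assms(2) by (simp add: real_sqrt_mult field_simps)
qed

section \<open>The hard-MAP solution\<close>

lemma norm_le_sqrt_card:
  fixes v :: "real^'a::finite"
  assumes "0 \<le> R" "\<And>i. \<bar>v $ i\<bar> \<le> R"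
  shows "norm v \<le> sqrt (CARD('a)) * R"
proof -
  have "(norm v)\<^sup>2 = (\<Sum>i\<in>UNIV. (v $ i)\<^sup>2)"
    by (simp add: norm_vec_def L2_set_def sum_nonneg)
  also have "\<dots> \<le> (\<Sum>i\<in>(UNIV :: 'a set). R\<^sup>2)"
    using assms by (intro sum_mono) (metis abs_le_square_iff abs_of_nonneg)
  also have "\<dots> = (sqrt (CARD('a)) * R)\<^sup>2"
    by (simp add: power_mult_distrib)
  finally show ?thesis
    by (rule power2_le_imp_le) (use assms(1) in simp)
qed

text \<open>The vector \<open>z v* A\<close> is the transpose of \<open>A\<close> applied to
  \<open>z\<close>. Its squared norm is the inner product of \<open>z\<close> with
  \<open>A *v (z v* A)\<close>, so the row bound on the action of \<open>A\<close> carries over to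
  the transpose after cancelling one factor.\<close>

lemma norm_vector_matrix_le:
  fixes A :: "real^'q::finite^'p::finite"
  assumes "0 \<le> B" "\<And>i. norm (A $ i) \<le> B"
  shows "norm (z v* A) \<le> sqrt (CARD('p)) * B * norm z"
proof -
  let ?v = "z v* A"
  have "norm (A *v ?v) \<le> sqrt (CARD('p)) * (B * norm ?v)"
  proof (rule norm_le_sqrt_card)
    fix i
    have "\<bar>(A *v ?v) $ i\<bar> \<le> norm (A $ i) * norm ?v"
      by (simp only: matrix_vector_mul_component Cauchy_Schwarz_ineq2)
    also have "\<dots> \<le> B * norm ?v"
      by (intro mult_right_mono assms) simp
    finally show "\<bar>(A *v ?v) $ i\<bar> \<le> B * norm ?v" .
  qed (use assms(1) in simp)
  then have "norm z * norm (A *v ?v) \<le> norm z * (sqrt (CARD('p)) * (B * norm ?v))"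
    by (rule mult_left_mono) simp
  moreover have "norm ?v * norm ?v = z \<bullet> (A *v ?v)"
    by (metis dot_lmul_matrix power2_eq_square power2_norm_eq_inner)
  ultimately have "norm ?v * norm ?v \<le> (sqrt (CARD('p)) * B * norm z) * norm ?v"
    using norm_cauchy_schwarz[of z "A *v ?v"] by (simp add: mult_ac)
  then show ?thesis
    using assms(1) by (cases "?v = 0") (simp_all del: vector_matrix_mult_0)
qed

locale map_problem =
  fixes A :: "real^'q::finite^'p::finite" and W :: "real^'q^'q" and wmin \<mu> :: real
  assumes W: "sym_pos_def W" and wmin: "0 < wmin" "mat wmin \<preceq>\<^sub>L W"
    and \<mu>: "0 < \<mu>" "\<mu> \<le> lambda_min (A ** matrix_inv W ** transpose A)"
begin

abbreviation M :: "real^'p^'p" where "M \<equiv> A ** matrix_inv W ** transpose A"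

text \<open>The vectors \<open>lift z\<close> are exactly the \<open>W\<close>-orthogonal complement
  of the kernel of \<open>A\<close>; \<open>z\<close> plays the role of a Lagrange
  multiplier.\<close>

abbreviation lift :: "real^'p \<Rightarrow> real^'q" where "lift z \<equiv> matrix_inv W *v (z v* A)"

lemma W_matrix_inv: "W *v (matrix_inv W *v v) = v"
  by (intro matrix_inv_mult_vector invertible_sym_pos_def W)

lemma W_inner_lift: "u \<bullet> (W *v lift z) = (A *v u) \<bullet> z"
  by (metis W_matrix_inv dot_lmul_matrix inner_commute)

lemma A_lift: "A *v lift z = M *v z"
  by (simp flip: matrix_vector_mul_assoc)

lemma norm_lift: "norm (lift z) \<le> norm (z v* A) / wmin"
  using coercive_imp_norm_le[OF wmin(1) loewner_mat_le[OF wmin(2)]] W_matrix_inv by metis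

text \<open>This presents \<open>M\<close> as the Gram form of \<open>lift\<close> in the
  \<open>W\<close>-inner product, so the symmetry of \<open>M\<close> can be read off from that of
  \<open>W\<close> without transposing \<open>matrix_inv W\<close>.\<close>

lemma inner_M: "u \<bullet> (M *v v) = lift u \<bullet> (W *v lift v)"
proof -
  have "u \<bullet> (M *v v) = lift v \<bullet> (W *v lift u)"
    unfolding W_inner_lift A_lift by (rule inner_commute)
  also have "\<dots> = lift u \<bullet> (W *v lift v)"
    using W by (intro inner_symmetric_matrix) (simp add: sym_pos_def_def)
  finally show ?thesis .
qed

lemma transpose_M: "transpose M = M"
proof -
  have "transpose M *v v = M *v v" for v
  proof (rule vector_eq_ldot[THEN iffD1], rule allI)
    fix u
    have "u \<bullet> (transpose M *v v) = v \<bullet> (M *v u)"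
      by (metis dot_lmul_matrix inner_commute transpose_matrix_vector)
    also have "\<dots> = lift u \<bullet> (W *v lift v)"
      unfolding inner_M using W by (intro inner_symmetric_matrix) (simp add: sym_pos_def_def)
    also have "\<dots> = u \<bullet> (M *v v)"
      by (rule inner_M[symmetric])
    finally show "u \<bullet> (transpose M *v v) = u \<bullet> (M *v v)" .
  qed
  then show ?thesis
    unfolding matrix_eq by blast
qed

text \<open>The Rayleigh bound makes the form of \<open>M\<close> coercive. The estimate serves
  twice: it makes \<open>M\<close> invertible, and it bounds the multiplier by the residual it
  corrects.\<close>

lemma norm_le_M: "norm z \<le> norm (M *v z) / \<mu>"
proof (rule coercive_imp_norm_le[OF \<mu>(1)])
  have "\<mu> * (norm z)\<^sup>2 \<le> lambda_min M * (norm z)\<^sup>2"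
    by (intro mult_right_mono \<mu>) simp
  then show "\<mu> * (norm z)\<^sup>2 \<le> z \<bullet> (M *v z)"
    using lambda_min_le_rayleigh[OF transpose_M, of z] by linarith
qed

lemma M_surj: "\<exists>z. M *v z = r"
proof -
  have "invertible M"
    by (rule invertible_if_kernel_trivial) (metis div_0 norm_le_M norm_le_zero_iff norm_zero)
  then show ?thesis
    using matrix_inv_mult_vector by blast
qed

text \<open>For a feasible \<open>c\<close>, the difference \<open>c - d\<close> lies in the kernel
  of \<open>A\<close> and is \<open>W\<close>-orthogonal to the lift \<open>d - c\<pi>\<close>.
  Pythagoras then shows that \<open>d\<close> minimizes the distance to
  \<open>c\<pi>\<close>.\<close>

lemma hard_MAP_lift:
  obtains z where "hard_MAP A b W c\<pi> = c\<pi> + lift z" "A *v hard_MAP A b W c\<pi> = b"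
proof -
  obtain z where z: "M *v z = b - A *v c\<pi>"
    using M_surj by blast
  define d where "d = c\<pi> + lift z"
  have d: "A *v d = b"
    using z by (simp add: d_def matrix_vector_right_distrib A_lift)
  have pythagoras: "(wnorm W (c - c\<pi>))\<^sup>2 = (wnorm W (c - d))\<^sup>2 + (wnorm W (d - c\<pi>))\<^sup>2"
    if "A *v c = b" for c
  proof -
    have "(c - d) \<bullet> (W *v (d - c\<pi>)) = (A *v (c - d)) \<bullet> z"
      unfolding d_def by (simp add: W_inner_lift del: vector_transpose_matrix)
    also have "\<dots> = 0"
      using that d by (simp add: matrix_vector_mult_diff_distrib)
    finally show ?thesis
      using wnorm_add_orthogonal[OF W, of "c - d" "d - c\<pi>"] by simp
  qed
  have "hard_MAP A b W c\<pi> = d"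
    unfolding hard_MAP_def
  \<comment> \<open>\<open>ARG_MIN\<close> chooses among minimizers, so uniqueness is needed too:
    optimality of \<open>c\<close> against \<open>d\<close> in \<open>pythagoras\<close> forces
    \<open>wnorm W (c - d) = 0\<close>.\<close>
  proof (rule arg_minI)
    fix c
    assume c: "A *v c = b"
      and min: "\<forall>c'. A *v c' = b \<longrightarrow>
        \<not> 1/2 * (wnorm W (c' - c\<pi>))\<^sup>2 < 1/2 * (wnorm W (c - c\<pi>))\<^sup>2"
    have "(wnorm W (c - d))\<^sup>2 \<le> 0"
      using min[rule_format, OF d] pythagoras[OF c] by simp
    then have "wnorm W (c - d) = 0"
      by simp
    then show "c = d"
      using norm_le_wnorm[OF W wmin, of "c - d"] by simp
  next
    show "A *v d = b"
      by (rule d)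
  next
    fix c
    assume "A *v c = b"
    from pythagoras[OF this]
    show "\<not> 1/2 * (wnorm W (c - c\<pi>))\<^sup>2 < 1/2 * (wnorm W (d - c\<pi>))\<^sup>2"
      by simp
  qed
  then show ?thesis
    using that d by (simp add: d_def)
qed

text \<open>
  Correcting \<open>l\<close> by \<open>lift z\<close> makes it feasible; since both \<open>lift z\<close> and the step
  of the MAP solution from the prior mean are \<open>W\<close>-orthogonal to the kernel of \<open>A\<close>,
  the remaining error is at most the prior error in the \<open>W\<close>-norm.
\<close>

lemma hard_MAP_error:
  fixes B R :: real
  assumes B: "0 \<le> B" "\<And>i. norm (A $ i) \<le> B"
    and R: "0 \<le> R" "\<And>i. \<bar>(b - A *v l) $ i\<bar> \<le> R"
  shows "norm (hard_MAP A b W c\<pi> - l) \<le> wnorm W (c\<pi> - l) / sqrt wmin + CARD('p) * B * R / (wmin * \<mu>)"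
proof -
  define c where "c = hard_MAP A b W c\<pi>"
  obtain y where y: "c = c\<pi> + lift y" and c: "A *v c = b"
    unfolding c_def using hard_MAP_lift by blast
  obtain z where z: "M *v z = b - A *v l"
    using M_surj by blast
  define d where "d = l + lift z"
  have ker: "A *v (c - d) = 0"
    using z c by (simp add: d_def matrix_vector_right_distrib matrix_vector_mult_diff_distrib A_lift)
  \<comment> \<open>Here \<open>c - d\<close> lies in the kernel of \<open>A\<close> and
    \<open>e\<close> is a lift, so \<open>(c - d) + e\<close> is the \<open>W\<close>-orthogonal
    decomposition of the prior error \<open>c\<pi> - l\<close>.\<close>
  define e where "e = c\<pi> - l - (c - d)"
  have "e = lift (z - y)"
    by (simp add: e_def d_def y vector_matrix_mult_diff_distrib matrix_vector_mult_diff_distrib)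
  then have "(c - d) \<bullet> (W *v e) = 0"
    using ker by (simp only: W_inner_lift inner_zero_left)
  then have "(wnorm W (c\<pi> - l))\<^sup>2 = (wnorm W (c - d))\<^sup>2 + (wnorm W e)\<^sup>2"
    using wnorm_add_orthogonal[OF W, of "c - d" e] by (simp add: e_def)
  then have "(wnorm W (c - d))\<^sup>2 \<le> (wnorm W (c\<pi> - l))\<^sup>2"
    using zero_le_power2[of "wnorm W e"] by linarith
  then have "wnorm W (c - d) \<le> wnorm W (c\<pi> - l)"
    by (rule power2_le_imp_le) (rule wnorm_nonneg[OF W])
  then have 1: "norm (c - d) \<le> wnorm W (c\<pi> - l) / sqrt wmin"
    using norm_le_wnorm[OF W wmin, of "c - d"] wmin(1)
    by (meson divide_right_mono order_trans real_sqrt_ge_zero less_imp_le)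
  have "norm (lift z) \<le> norm (z v* A) / wmin"
    by (rule norm_lift)
  also have "\<dots> \<le> (sqrt (CARD('p)) * B * norm z) / wmin"
    using wmin(1) by (intro divide_right_mono norm_vector_matrix_le B) simp
  \<comment> \<open>A second factor \<open>sqrt (CARD('p))\<close> arises in passing from the
    entries of the residual to its norm. With the one from the transpose of \<open>A\<close> it
    yields the full \<open>CARD('p)\<close>.\<close>
  also have "\<dots> \<le> (sqrt (CARD('p)) * B * ((sqrt (CARD('p)) * R) / \<mu>)) / wmin"
  proof -
    have "norm z \<le> norm (b - A *v l) / \<mu>"
      using norm_le_M[of z] by (simp only: z)
    also have "\<dots> \<le> (sqrt (CARD('p)) * R) / \<mu>"
      using \<mu>(1) by (intro divide_right_mono norm_le_sqrt_card R) simp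
    finally show ?thesis
      using wmin(1) B(1) by (intro divide_right_mono mult_left_mono) simp_all
  qed
  also have "\<dots> = CARD('p) * B * R / (wmin * \<mu>)"
    by (simp add: field_simps)
  finally have 2: "norm (lift z) \<le> CARD('p) * B * R / (wmin * \<mu>)" .
  have "c - l = (c - d) + lift z"
    by (simp add: d_def)
  then have "norm (c - l) \<le> norm (c - d) + norm (lift z)"
    by (metis norm_triangle_ineq)
  then show ?thesis
    using 1 2 by (simp add: c_def)
qed

end

section \<open>Gradients and first-order Taylor expansion\<close>

lemma gradient_eqI:
  assumes "GDERIV f x :> D"
  shows "gradient f x = D"
  unfolding gradient_def
proof (rule the_equality)
  show "GDERIV f x :> D"
    by (rule assms)
  fix D'
  assume "GDERIV f x :> D'"
  then have "(\<lambda>h. h \<bullet> D') = (\<lambda>h. h \<bullet> D)"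
    using assms unfolding gderiv_def by (rule has_derivative_unique)
  then show "D' = D"
    by (metis vector_eq_rdot inner_commute)
qed

text \<open>The gradient is the Riesz representative of the derivative, obtained as
  \<open>adjoint f' 1\<close>.\<close>

lemma GDERIV_gradient:
  fixes f :: "'a::euclidean_space \<Rightarrow> real"
  assumes "f differentiable (at x)"
  shows "GDERIV f x :> gradient f x"
proof -
  obtain f' where f': "(f has_derivative f') (at x)"
    using assms by (auto simp: differentiable_def)
  then have "f' = (\<lambda>h. h \<bullet> adjoint f' 1)"
    using adjoint_works[OF has_derivative_linear] by fastforce
  then have "GDERIV f x :> adjoint f' 1"
    using f' by (simp add: gderiv_def)
  then show ?thesis
    using gradient_eqI[of f x] by simp
qed

text \<open>A monotonicity argument along the segment takes the place of integrating the
  gradient.\<close>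

lemma taylor_le_Lipschitz_gradient:
  fixes f :: "'a::euclidean_space \<Rightarrow> real"
  assumes diff: "\<And>z. z \<in> closed_segment x y \<Longrightarrow> f differentiable (at z)"
    and lip: "\<And>z. z \<in> closed_segment x y \<Longrightarrow> norm (gradient f z - gradient f x) \<le> L * norm (z - x)"
  shows "f y - f x - gradient f x \<bullet> (y - x) \<le> L / 2 * (norm (y - x))\<^sup>2"
    "f x + gradient f x \<bullet> (y - x) - f y \<le> L / 2 * (norm (y - x))\<^sup>2"
proof -
  define d where "d = y - x"
  have seg: "x + t *\<^sub>R d \<in> closed_segment x y" if "0 \<le> t" "t \<le> 1" for t
    using that unfolding in_segment d_def by (intro exI[of _ t]) (simp add: algebra_simps)
  \<comment> \<open>The sign \<open>s\<close> handles both one-sided estimates at once.\<close>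
  have bound: "s * (f y - f x - gradient f x \<bullet> d) \<le> L / 2 * (norm d)\<^sup>2" if s: "\<bar>s\<bar> = 1" for s
  proof -
    \<comment> \<open>The subtracted quadratic has derivative
      \<open>L * t * (norm d)\<^sup>2\<close>, which dominates that of the signed linearization
      error. So \<open>p\<close> is nonincreasing, and \<open>p 1 \<le> p 0\<close> is the
      claim.\<close>
    define p where "p t = s * (f (x + t *\<^sub>R d) - t * (gradient f x \<bullet> d)) - L / 2 * t\<^sup>2 * (norm d)\<^sup>2" for t
    have "p 1 \<le> p 0"
    proof (rule DERIV_nonpos_imp_nonincreasing[where f = p])
      fix t :: real
      assume t: "0 \<le> t" "t \<le> 1"
      let ?z = "x + t *\<^sub>R d"
      have "((\<lambda>t. f (x + t *\<^sub>R d)) has_derivative (\<lambda>h. (h *\<^sub>R d) \<bullet> gradient f ?z)) (at t)"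
        using GDERIV_gradient[OF diff[OF seg[OF t]]] unfolding gderiv_def
        by (rule has_derivative_compose[rotated]) (auto intro!: derivative_eq_intros)
      then have "((\<lambda>t. f (x + t *\<^sub>R d)) has_real_derivative gradient f ?z \<bullet> d) (at t)"
        unfolding has_field_derivative_def
        by (rule has_derivative_eq_rhs) (simp add: fun_eq_iff inner_commute)
      note [derivative_intros] = this
      have D: "(p has_real_derivative s * ((gradient f ?z - gradient f x) \<bullet> d) - L * t * (norm d)\<^sup>2) (at t)"
        unfolding p_def by (auto intro!: derivative_eq_intros simp: inner_diff_left algebra_simps)
      have "s * ((gradient f ?z - gradient f x) \<bullet> d) \<le> \<bar>(gradient f ?z - gradient f x) \<bullet> d\<bar>"
        using s by (metis abs_ge_self abs_mult mult_1)
      also have "\<dots> \<le> norm (gradient f ?z - gradient f x) * norm d"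
        by (rule Cauchy_Schwarz_ineq2)
      also have "\<dots> \<le> (L * norm (?z - x)) * norm d"
        by (intro mult_right_mono lip seg t) simp
      also have "\<dots> = L * t * (norm d)\<^sup>2"
        using t by (simp add: power2_eq_square)
      finally show "\<exists>D. DERIV p t :> D \<and> D \<le> 0"
        using D by force
    qed simp
    then show ?thesis
      by (simp add: p_def d_def algebra_simps)
  qed
  show "f y - f x - gradient f x \<bullet> (y - x) \<le> L / 2 * (norm (y - x))\<^sup>2"
    "f x + gradient f x \<bullet> (y - x) - f y \<le> L / 2 * (norm (y - x))\<^sup>2"
    using bound[of 1] bound[of "-1"] by (simp_all add: d_def)
qed

section \<open>Quadratic models and their coefficient vectors\<close>

lemma inner_blocks:
  "u \<bullet> v = const_part u * const_part v + lin_part u \<bullet> lin_part v + quad_part u \<bullet> quad_part v"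
  by (simp add: inner_vec_def const_part_def lin_part_def quad_part_def UNIV_Plus_UNIV[symmetric]
      sum.Plus UNIV_unit del: UNIV_Plus_UNIV)

lemma norm_lin_part: "norm (lin_part c) \<le> norm c"
  using inner_blocks[of c c] by (auto intro!: real_sqrt_le_mono simp: norm_eq_sqrt_inner)

lemma norm_quad_part: "norm (quad_part c) \<le> norm c"
  using inner_blocks[of c c] by (auto intro!: real_sqrt_le_mono simp: norm_eq_sqrt_inner)

lemma parts_blocks [simp]:
  "const_part (blocks a g h) = a" "lin_part (blocks a g h) = g" "quad_part (blocks a g h) = h"
  by (simp_all add: blocks_def const_part_def lin_part_def quad_part_def vec_eq_iff)

lemma parts_diff:
  "lin_part (u - v) = lin_part u - lin_part v" "quad_part (u - v) = quad_part u - quad_part v"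
  by (simp_all add: lin_part_def quad_part_def vec_eq_iff)

lemma inner_phihat: "phihat u \<bullet> c = const_part c + u \<bullet> lin_part c + qvec u \<bullet> quad_part c"
  by (simp add: inner_blocks phihat_def)

lemma continuous_on_phihat: "continuous_on S phihat"
  unfolding phihat_def blocks_def qvec_def
proof (rule continuous_on_vec_lambda)
  fix a :: "'a quad_ix"
  consider "a = Inl ()" | i where "a = Inr (Inl i)" | p where "a = Inr (Inr p)"
    by (metis (full_types) old.sum.exhaust old.unit.exhaust)
  then show "continuous_on S (\<lambda>u. case a of Inl _ \<Rightarrow> 1 | Inr (Inl i) \<Rightarrow> u $ i
      | Inr (Inr p) \<Rightarrow> (\<chi> p. if row_ix p = col_ix p then 1/2 * (u $ row_ix p)\<^sup>2
                              else u $ row_ix p * u $ col_ix p) $ p)"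
  proof cases
    case (3 p)
    then show ?thesis
      by (cases "row_ix p = col_ix p") (auto intro!: continuous_intros)
  qed (auto intro!: continuous_intros)
qed

text \<open>A real supremum is an upper bound only for a set bounded above; here continuity of
  \<open>phihat\<close> and compactness of the ball provide the bound.\<close>

lemma norm_phihat_le_SUP:
  fixes u :: "real^'n::{finite,linorder}"
  assumes "norm u \<le> r"
  shows "norm (phihat u) \<le> (SUP u\<in>cball (0 :: real^'n::{finite,linorder}) r. norm (phihat u))"
proof (rule cSUP_upper[where f = "\<lambda>u. norm (phihat u)"])
  have "compact ((\<lambda>u. norm (phihat u)) ` cball (0 :: real^'n::{finite,linorder}) r)"
    by (intro compact_continuous_image continuous_on_norm continuous_on_phihat compact_cball)
  then show "bdd_above ((\<lambda>u. norm (phihat u)) ` cball (0 :: real^'n::{finite,linorder}) r)"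
    by (intro bounded_imp_bdd_above compact_imp_bounded)
qed (use assms in simp)

text \<open>The norm of the matrix type is the Frobenius norm. It counts each off-diagonal entry
  twice and \<open>vech\<close> counts it once; doubling the diagonal as well gives the factor 2 for
  the squares.\<close>

lemma norm_matrix_le_vech:
  assumes "transpose H = H"
  shows "norm H \<le> sqrt 2 * norm (vech H)"
proof -
  have sym: "H $ j $ i = H $ i $ j" for i j
    using assms by (metis transpose_def vec_lambda_beta)
  let ?g = "\<lambda>i j. (H $ i $ j)\<^sup>2"
  have "(norm H)\<^sup>2 = (\<Sum>i\<in>UNIV. \<Sum>j\<in>UNIV. ?g i j)"
    by (simp add: norm_vec_def L2_set_def sum_nonneg)
  also have "\<dots> = (\<Sum>i\<in>UNIV. ?g i i) + 2 * (\<Sum>(i, j) | i < j. ?g i j)"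
    unfolding sum_square_split by (simp add: sym sum_distrib_left case_prod_beta)
  also have "\<dots> \<le> 2 * ((\<Sum>i\<in>UNIV. ?g i i) + (\<Sum>(i, j) | i < j. ?g i j))"
    by (simp add: sum_nonneg)
  also have "\<dots> = 2 * (\<Sum>p\<in>UNIV. ?g (row_ix p) (col_ix p))"
    by (simp only: sum_upper[of ?g] sum_upper_split)
  also have "\<dots> = (sqrt 2 * norm (vech H))\<^sup>2"
    by (simp add: norm_vec_def L2_set_def sum_nonneg vech_def power_mult_distrib)
  finally show ?thesis
    by (rule power2_le_imp_le) simp
qed

text \<open>Cauchy-Schwarz in each row: the Frobenius norm dominates the operator norm.\<close>

lemma norm_matrix_vector_le:
  fixes H :: "real^'n::finite^'m::finite"
  shows "norm (H *v v) \<le> norm H * norm v"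
proof -
  have "norm (H *v v) \<le> L2_set (\<lambda>i. norm (H $ i) * norm v) UNIV"
    unfolding norm_vec_def[of "H *v v"]
    by (intro L2_set_mono)
      (simp_all only: matrix_vector_mul_component real_norm_def Cauchy_Schwarz_ineq2 abs_ge_zero)
  then show ?thesis
    by (simp add: L2_set_left_distrib norm_vec_def[of H])
qed

lemma gradient_quadratic:
  fixes H :: "real^'n::finite^'n"
  assumes "transpose H = H"
  shows "gradient (\<lambda>s. a + g \<bullet> s + 1/2 * (s \<bullet> (H *v s))) s = g + H *v s"
proof (rule gradient_eqI)
  have lin: "((*v) H has_derivative (*v) H) (at s)"
    by (rule bounded_linear_imp_has_derivative) (rule matrix_vector_mul_bounded_linear)
  show "GDERIV (\<lambda>s. a + g \<bullet> s + 1/2 * (s \<bullet> (H *v s))) s :> g + H *v s"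
    unfolding gderiv_def
    by (rule derivative_eq_intros lin refl)+
      (simp add: inner_add_right inner_symmetric_matrix[OF assms, of s] inner_commute fun_eq_iff)
qed

section \<open>From the coefficient error to full linearity and the Hessian bound\<close>

theorem lemma4p12:
  fixes f :: "real^'n::{finite,linorder} \<Rightarrow> real"
    and x :: "nat \<Rightarrow> real^'n::{finite,linorder}"
    and \<Delta> :: "nat \<Rightarrow> real"
    and y :: "nat \<Rightarrow> 'p::finite \<Rightarrow> real^'n::{finite,linorder}"
    and i0 :: 'p
    and m :: nat
    and A :: "nat \<Rightarrow> real^('n::{finite,linorder} quad_ix)^'p"
    and b :: "nat \<Rightarrow> real^'p"
    and W :: "nat \<Rightarrow> real^('n::{finite,linorder} quad_ix)^('n::{finite,linorder} quad_ix)"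
    and c\<pi> cl c :: "nat \<Rightarrow> real^('n::{finite,linorder} quad_ix)"
    and g :: "nat \<Rightarrow> real^'n::{finite,linorder}"
    and H :: "nat \<Rightarrow> real^'n::{finite,linorder}^'n::{finite,linorder}"
    and mdl :: "nat \<Rightarrow> real^'n::{finite,linorder} \<Rightarrow> real"
    and \<Omega> :: "(real^'n::{finite,linorder}) set"
    and \<Delta>max ctrim Lg finf wmin wmax \<mu>M \<kappa>\<pi> B\<phi> B\<phi>geo \<kappa>e :: real
  assumes radius: "\<And>k. 0 < \<Delta> k \<and> \<Delta> k \<le> \<Delta>max"
    and ctrim: "1 \<le> ctrim"
    and card_Y: "CARD('p) = m + 1"
    and Y_center: "\<And>k. y k i0 = x k"
    and Y_ball: "\<And>k i. y k i \<in> cball (x k) (ctrim * \<Delta> k)"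
    and A_eq: "\<And>k. A k = design_matrix (x k) (\<Delta> k) (y k)"
    and b_eq: "\<And>k. b k = (\<chi> i. f (y k i))"
    and W_spd: "\<And>k. sym_pos_def (W k)"
    \<comment> \<open>(i)\<close>
    and \<Omega>_open: "open \<Omega>"
    and \<Omega>_balls: "\<And>k. cball (x k) (\<Delta> k) \<subseteq> \<Omega>"
    and \<Omega>_segments: "\<And>k i. closed_segment (x k) (y k i) \<subseteq> \<Omega>"
    and f_diff: "\<And>z. z \<in> \<Omega> \<Longrightarrow> f differentiable (at z)"
    and f_C1: "continuous_on \<Omega> (gradient f)"
    and Lg_pos: "0 < Lg"
    and f_Lip: "\<And>z z'. z \<in> \<Omega> \<Longrightarrow> z' \<in> \<Omega> \<Longrightarrow>
                  norm (gradient f z - gradient f z') \<le> Lg * norm (z - z')"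
    and f_below: "\<And>z. finf \<le> f z"
    \<comment> \<open>(ii)\<close>
    and w_bounds: "0 < wmin" "wmin \<le> wmax"
    and W_bounds: "\<And>k. mat wmin \<preceq>\<^sub>L W k \<and> W k \<preceq>\<^sub>L mat wmax"
    \<comment> \<open>(iii)\<close>
    and \<mu>M_pos: "0 < \<mu>M"
    and M_bound: "\<And>k. \<mu>M \<le> lambda_min (A k ** matrix_inv (W k) ** transpose (A k))"
    \<comment> \<open>(iv)\<close>
    and \<kappa>\<pi>_nonneg: "0 \<le> \<kappa>\<pi>"
    and cl_eq: "\<And>k. cl k = blocks (f (x k)) (\<Delta> k *\<^sub>R gradient f (x k)) 0"
    and prior_bound: "\<And>k. wnorm (W k) (c\<pi> k - cl k) \<le> \<kappa>\<pi> * (\<Delta> k)\<^sup>2"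
    \<comment> \<open>the hard-MAP solution and its model\<close>
    and c_eq: "\<And>k. c k = hard_MAP (A k) (b k) (W k) (c\<pi> k)"
    and g_eq: "\<And>k. g k = (1 / \<Delta> k) *\<^sub>R lin_part (c k)"
    and H_sym: "\<And>k. transpose (H k) = H k"
    and H_eq: "\<And>k. vech (H k) = (1 / (\<Delta> k)\<^sup>2) *\<^sub>R quad_part (c k)"
    and mdl_eq: "\<And>k s. mdl k s = const_part (c k) + g k \<bullet> s + 1/2 * (s \<bullet> (H k *v s))"
    \<comment> \<open>constants\<close>
    and B\<phi>_eq: "B\<phi> = (SUP u\<in>cball (0 :: real^'n::{finite,linorder}) 1. norm (phihat u))"
    and B\<phi>geo_eq: "B\<phi>geo = (SUP u\<in>cball (0 :: real^'n::{finite,linorder}) ctrim. norm (phihat u))"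
    and \<kappa>e_eq: "\<kappa>e = \<kappa>\<pi> / sqrt wmin
                      + ctrim\<^sup>2 * B\<phi>geo * Lg * (real m + 1) / (2 * wmin * \<mu>M)"
  shows "\<forall>k. fully_linear f (mdl k) (x k) (\<Delta> k)
               (Lg / 2 + B\<phi> * \<kappa>e) (Lg + (1 + sqrt 2) * \<kappa>e)
             \<and> spectral_norm (H k) \<le> sqrt 2 * \<kappa>e"
proof
  fix k
  let ?x = "x k" and ?\<Delta> = "\<Delta> k" and ?G = "gradient f (x k)"
  have \<Delta>: "0 < ?\<Delta>"
    using radius by blast
  have x_in: "?x \<in> \<Omega>"
    using \<Omega>_balls[of k] \<Delta> by auto
  \<comment> \<open>Stated for any segment inside \<open>\<Omega>\<close>, so that it covers both
    the interpolation points, which may lie outside the trust region, and the points of the trust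
    region itself.\<close>
  have taylor: "\<bar>f z - (f ?x + ?G \<bullet> (z - ?x))\<bar> \<le> Lg / 2 * (norm (z - ?x))\<^sup>2"
    if "closed_segment ?x z \<subseteq> \<Omega>" for z
  proof -
    have "f z - f ?x - ?G \<bullet> (z - ?x) \<le> Lg / 2 * (norm (z - ?x))\<^sup>2"
      "f ?x + ?G \<bullet> (z - ?x) - f z \<le> Lg / 2 * (norm (z - ?x))\<^sup>2"
      by (rule taylor_le_Lipschitz_gradient; use that x_in in \<open>blast intro: f_diff f_Lip\<close>)+
    then show ?thesis
      by linarith
  qed
  have cl: "phihat (s /\<^sub>R ?\<Delta>) \<bullet> cl k = f ?x + ?G \<bullet> s" for s
    using \<Delta> by (simp add: cl_eq inner_phihat inner_commute)
  have c: "phihat (s /\<^sub>R ?\<Delta>) \<bullet> c k = mdl k s" for s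
  proof -
    have "quad_part (c k) = ?\<Delta>\<^sup>2 *\<^sub>R vech (H k)"
      using \<Delta> by (simp add: H_eq)
    then have "qvec (s /\<^sub>R ?\<Delta>) \<bullet> quad_part (c k) = 1/2 * (s \<bullet> (H k *v s))"
      using \<Delta> by (simp add: qvec_vech[OF H_sym] matrix_vector_mult_scaleR field_simps power2_eq_square)
    moreover have "(s /\<^sub>R ?\<Delta>) \<bullet> lin_part (c k) = g k \<bullet> s"
      by (simp add: g_eq inner_commute divide_inverse)
    ultimately show ?thesis
      by (simp only: inner_phihat mdl_eq)
  qed
  have B: "norm (phihat u) \<le> B\<phi>" if "norm u \<le> 1" for u :: "real^'n::{finite,linorder}"
    unfolding B\<phi>_eq by (rule norm_phihat_le_SUP[OF that])
  have Bgeo: "norm (phihat u) \<le> B\<phi>geo" if "norm u \<le> ctrim" for u :: "real^'n::{finite,linorder}"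
    unfolding B\<phi>geo_eq by (rule norm_phihat_le_SUP[OF that])
  have row: "norm (A k $ i) \<le> B\<phi>geo" for i
  proof -
    have "norm (y k i - ?x) \<le> ctrim * ?\<Delta>"
      using Y_ball[of k i] by (simp add: dist_norm norm_minus_commute)
    then have "norm ((y k i - ?x) /\<^sub>R ?\<Delta>) \<le> ctrim"
      unfolding norm_scaleR using \<Delta> by (simp add: field_simps)
    then show ?thesis
      by (simp add: A_eq design_matrix_def Bgeo)
  qed
  \<comment> \<open>The remainder is taken at distance up to \<open>ctrim * ?\<Delta>\<close>; this
    is the origin of \<open>ctrim\<^sup>2\<close> in \<open>\<kappa>e\<close>.\<close>
  have residual: "\<bar>(b k - A k *v cl k) $ i\<bar> \<le> Lg / 2 * (ctrim * ?\<Delta>)\<^sup>2" for i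
  proof -
    have "(b k - A k *v cl k) $ i = f (y k i) - (f ?x + ?G \<bullet> (y k i - ?x))"
      by (simp only: vector_minus_component matrix_vector_mul_component A_eq design_matrix_def
          b_eq vec_lambda_beta cl)
    then have "\<bar>(b k - A k *v cl k) $ i\<bar> \<le> Lg / 2 * (norm (y k i - ?x))\<^sup>2"
      using taylor[OF \<Omega>_segments[of k i]] by simp
    also have "\<dots> \<le> Lg / 2 * (ctrim * ?\<Delta>)\<^sup>2"
      using Y_ball[of k i] Lg_pos
      by (intro mult_left_mono power_mono) (auto simp: dist_norm norm_minus_commute)
    finally show ?thesis .
  qed
  interpret map_problem "A k" "W k" wmin \<mu>M
    by unfold_locales (use W_spd w_bounds W_bounds \<mu>M_pos M_bound in auto)
  have "norm (c k - cl k) \<le> wnorm (W k) (c\<pi> k - cl k) / sqrt wmin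
      + CARD('p) * B\<phi>geo * (Lg / 2 * (ctrim * ?\<Delta>)\<^sup>2) / (wmin * \<mu>M)"
    unfolding c_eq using Lg_pos
    \<comment> \<open>The row norm at \<open>i0\<close> witnesses that \<open>B\<phi>geo\<close> is
      nonnegative.\<close>
    by (intro hard_MAP_error row residual order_trans[OF norm_ge_zero row[of i0]]) simp_all
  also have "\<dots> \<le> \<kappa>\<pi> * ?\<Delta>\<^sup>2 / sqrt wmin
      + CARD('p) * B\<phi>geo * (Lg / 2 * (ctrim * ?\<Delta>)\<^sup>2) / (wmin * \<mu>M)"
    using w_bounds prior_bound[of k] by (intro add_right_mono divide_right_mono) simp_all
  also have "\<dots> = \<kappa>e * ?\<Delta>\<^sup>2"
    by (simp add: \<kappa>e_eq card_Y power_mult_distrib algebra_simps)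
  finally have err: "norm (c k - cl k) \<le> \<kappa>e * ?\<Delta>\<^sup>2" .
  \<comment> \<open>The quadratic block of \<open>cl k\<close> is zero, so the Hessian coefficients
    are pure error; unscaling by \<open>?\<Delta>\<^sup>2\<close> cancels the order of that error
    and leaves a bound uniform in \<open>k\<close>.\<close>
  have "norm (vech (H k)) = norm (quad_part (c k - cl k)) / ?\<Delta>\<^sup>2"
    using \<Delta> by (simp add: H_eq parts_diff cl_eq divide_inverse)
  also have "\<dots> \<le> \<kappa>e * ?\<Delta>\<^sup>2 / ?\<Delta>\<^sup>2"
    using order_trans[OF norm_quad_part err] by (intro divide_right_mono) simp_all
  finally have "norm (vech (H k)) \<le> \<kappa>e"
    using \<Delta> by simp
  then have H: "norm (H k) \<le> sqrt 2 * \<kappa>e"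
    using norm_matrix_le_vech[OF H_sym, of k]
    by (meson mult_left_mono order_trans real_sqrt_ge_zero zero_le_numeral)
  have Hv: "norm (H k *v v) \<le> (sqrt 2 * \<kappa>e) * norm v" for v
    using norm_matrix_vector_le[of "H k" v] H
    by (meson mult_right_mono norm_ge_zero order_trans)
  have "norm (?G - g k) = norm (lin_part (c k - cl k)) / ?\<Delta>"
  proof -
    have "?G - g k = (- 1 / ?\<Delta>) *\<^sub>R lin_part (c k - cl k)"
      using \<Delta> by (simp add: g_eq parts_diff cl_eq algebra_simps)
    then show ?thesis
      using \<Delta> by simp
  qed
  also have "\<dots> \<le> \<kappa>e * ?\<Delta>\<^sup>2 / ?\<Delta>"
    using \<Delta> order_trans[OF norm_lin_part err] by (intro divide_right_mono) simp_all
  finally have g_err: "norm (?G - g k) \<le> \<kappa>e * ?\<Delta>"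
    using \<Delta> by (simp add: power2_eq_square)
  have "fully_linear f (mdl k) ?x ?\<Delta> (Lg / 2 + B\<phi> * \<kappa>e) (Lg + (1 + sqrt 2) * \<kappa>e)"
    unfolding fully_linear_def
  proof (intro allI impI conjI)
    fix s :: "real^'n::{finite,linorder}"
    assume s: "norm s \<le> ?\<Delta>"
    have s_in: "?x + s \<in> cball ?x ?\<Delta>"
      using s by (simp add: dist_norm)
    have "closed_segment ?x (?x + s) \<subseteq> \<Omega>"
      using s_in \<Delta> \<Omega>_balls[of k] closed_segment_subset[of ?x "cball ?x ?\<Delta>" "?x + s"] by auto
    from taylor[OF this] have "\<bar>f (?x + s) - (f ?x + ?G \<bullet> s)\<bar> \<le> Lg / 2 * (norm s)\<^sup>2"
      by simp
    also have "\<dots> \<le> Lg / 2 * ?\<Delta>\<^sup>2"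
      using s Lg_pos by (intro mult_left_mono power_mono) simp_all
    finally have 1: "\<bar>f (?x + s) - (f ?x + ?G \<bullet> s)\<bar> \<le> Lg / 2 * ?\<Delta>\<^sup>2" .
    \<comment> \<open>The rest of the value error is a pairing with the coefficient error. Since
      \<open>s /\<^sub>R ?\<Delta>\<close> lies in the unit ball, Cauchy-Schwarz brings in
      \<open>B\<phi>\<close>.\<close>
    have "mdl k s - (f ?x + ?G \<bullet> s) = phihat (s /\<^sub>R ?\<Delta>) \<bullet> (c k - cl k)"
      by (simp only: inner_diff_right c cl)
    then have "\<bar>mdl k s - (f ?x + ?G \<bullet> s)\<bar> \<le> norm (phihat (s /\<^sub>R ?\<Delta>)) * norm (c k - cl k)"
      by (simp add: Cauchy_Schwarz_ineq2)
    also have "\<dots> \<le> B\<phi> * (\<kappa>e * ?\<Delta>\<^sup>2)"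
    proof -
      have "norm (phihat (s /\<^sub>R ?\<Delta>)) \<le> B\<phi>"
        using s \<Delta> by (intro B) (simp add: field_simps)
      then show ?thesis
        by (intro mult_mono err) (auto intro: order_trans[OF norm_ge_zero])
    qed
    finally have "\<bar>f (?x + s) - mdl k s\<bar> \<le> Lg / 2 * ?\<Delta>\<^sup>2 + B\<phi> * (\<kappa>e * ?\<Delta>\<^sup>2)"
      using 1 by linarith
    then show "\<bar>f (?x + s) - mdl k s\<bar> \<le> (Lg / 2 + B\<phi> * \<kappa>e) * ?\<Delta>\<^sup>2"
      by (simp add: algebra_simps)
    have "gradient (mdl k) s = g k + H k *v s"
      using gradient_quadratic[OF H_sym, of "const_part (c k)" "g k" k s]
      by (simp only: mdl_eq[abs_def])
    \<comment> \<open>The three terms are the variation of the true gradient, the error of the model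
      gradient at the center and the Hessian term; they contribute \<open>Lg\<close>,
      \<open>\<kappa>e\<close> and \<open>sqrt 2 * \<kappa>e\<close> to the constant.\<close>
    then have "norm (gradient f (?x + s) - gradient (mdl k) s)
        = norm ((gradient f (?x + s) - ?G) + (?G - g k) - H k *v s)"
      by (simp add: algebra_simps)
    also have "\<dots> \<le> norm (gradient f (?x + s) - ?G) + norm (?G - g k) + norm (H k *v s)"
      by (meson add_mono norm_triangle_ineq norm_triangle_ineq4 order_refl order_trans)
    also have "\<dots> \<le> Lg * ?\<Delta> + \<kappa>e * ?\<Delta> + sqrt 2 * \<kappa>e * ?\<Delta>"
    proof (intro add_mono g_err)
      have "norm (gradient f (?x + s) - ?G) \<le> Lg * norm s"
        using f_Lip[of "?x + s" ?x] x_in s_in \<Omega>_balls[of k] by auto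
      then show "norm (gradient f (?x + s) - ?G) \<le> Lg * ?\<Delta>"
        using s Lg_pos by (meson mult_left_mono less_imp_le order_trans)
      have "0 \<le> sqrt 2 * \<kappa>e"
        using H norm_ge_zero order_trans by blast
      then show "norm (H k *v s) \<le> sqrt 2 * \<kappa>e * ?\<Delta>"
        using Hv[of s] s by (meson mult_left_mono order_trans)
    qed
    finally show "norm (gradient f (?x + s) - gradient (mdl k) s) \<le> (Lg + (1 + sqrt 2) * \<kappa>e) * ?\<Delta>"
      by (simp add: algebra_simps)
  qed
  moreover have "spectral_norm (H k) \<le> sqrt 2 * \<kappa>e"
    unfolding spectral_norm_def by (rule onorm_le) (rule Hv)
  ultimately show "fully_linear f (mdl k) ?x ?\<Delta> (Lg / 2 + B\<phi> * \<kappa>e) (Lg + (1 + sqrt 2) * \<kappa>e)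
      \<and> spectral_norm (H k) \<le> sqrt 2 * \<kappa>e" ..
qed

end
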